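(* Let $(\zeta^{(k)})_{k\in\mathbb{N}}$ be a sequence of pairwise distinct elements of the unit sphere of $\ell^2$ that is dense in this unit sphere, and let $B:\ell^1\to\ell^2$ be the bounded linear operator $Bx=\sum_{k=1}^\infty x_k\,\zeta^{(k)}$ for $x=(x_1,x_2,\ldots)\in\ell^1$. Then there exists a closed infinite-dimensional subspace $U\subseteq\ell^1$, isomorphic to $\ell^1$, such that the restriction $B|_U:U\to\ell^2$ of $B$ to $U$ is injective, is weak*-to-weak continuous, and has range $\mathcal{R}(B|_U)$ dense in $\ell^2$, where weak*-convergence in $\ell^1$ is understood with regard to the predual space $c_0$.
   Context: The sequence spaces $\ell^1$, $\ell^2$, $c_0$ (indexed by $\mathbb{N}=\{1,2,\ldots\}$) are real. $\ell^1$ is identified with the dual of $c_0$ via $\langle x,c\rangle=\sum_k x_kc_k$, and $U$ carries the weak* convergence inherited from $\ell^1$. Isomorphic means linearly homeomorphic. *)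

theory Defs
  imports "HOL-Analysis.Analysis"
begin

text \<open>Real sequences are functions on \<^typ>\<open>nat\<close>, so the indices are \<open>0, 1, 2, \<dots>\<close>
  rather than \<open>1, 2, 3, \<dots>\<close>.\<close>

section \<open>The space of absolutely summable sequences\<close>

typedef ell1 = "{x :: nat \<Rightarrow> real. summable (\<lambda>k. \<bar>x k\<bar>)}"
  morphisms ell1_nth Abs_ell1
  by (rule exI[of _ "\<lambda>_. 0"]) simp

setup_lifting type_definition_ell1

lemma summable_ell1_nth: "summable (\<lambda>k. \<bar>ell1_nth x k\<bar>)"
  using ell1_nth[of x] by simp

instantiation ell1 :: real_normed_vector
begin

lift_definition zero_ell1 :: ell1 is "\<lambda>_. 0" by simp

lift_definition plus_ell1 :: "ell1 \<Rightarrow> ell1 \<Rightarrow> ell1" is "\<lambda>x y k. x k + y k"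
proof -
  fix x y :: "nat \<Rightarrow> real"
  assume "summable (\<lambda>k. \<bar>x k\<bar>)" "summable (\<lambda>k. \<bar>y k\<bar>)"
  then have "summable (\<lambda>k. \<bar>x k\<bar> + \<bar>y k\<bar>)" by (rule summable_add)
  then show "summable (\<lambda>k. \<bar>x k + y k\<bar>)"
    by (rule summable_comparison_test'[where N = 0]) auto
qed

lift_definition uminus_ell1 :: "ell1 \<Rightarrow> ell1" is "\<lambda>x k. - x k" by simp

lift_definition scaleR_ell1 :: "real \<Rightarrow> ell1 \<Rightarrow> ell1" is "\<lambda>r x k. r * x k"
  by (simp add: abs_mult summable_mult)

lift_definition norm_ell1 :: "ell1 \<Rightarrow> real" is "\<lambda>x. \<Sum>k. \<bar>x k\<bar>" .

definition minus_ell1 :: "ell1 \<Rightarrow> ell1 \<Rightarrow> ell1" where "x - y = x + - (y :: ell1)"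
definition dist_ell1 :: "ell1 \<Rightarrow> ell1 \<Rightarrow> real" where "dist x y = norm (x - y :: ell1)"
definition sgn_ell1 :: "ell1 \<Rightarrow> ell1" where "sgn x = inverse (norm x) *\<^sub>R (x :: ell1)"
definition uniformity_ell1 :: "(ell1 \<times> ell1) filter"
  where "uniformity_ell1 = (INF e\<in>{0<..}. principal {(x, y). dist x y < e})"
definition open_ell1 :: "ell1 set \<Rightarrow> bool"
  where "open_ell1 U \<longleftrightarrow> (\<forall>x\<in>U. eventually (\<lambda>(x', y). x' = x \<longrightarrow> y \<in> U) uniformity)"

instance
proof
  fix x y z :: ell1 and a b :: real and U :: "ell1 set"
  show "x + y + z = x + (y + z)" by transfer auto
  show "x + y = y + x" by transfer auto
  show "0 + x = x" by transfer auto
  show "- x + x = 0" by transfer auto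
  show "x - y = x + - y" by (fact minus_ell1_def)
  show "a *\<^sub>R (x + y) = a *\<^sub>R x + a *\<^sub>R y" by transfer (auto simp: algebra_simps)
  show "(a + b) *\<^sub>R x = a *\<^sub>R x + b *\<^sub>R x" by transfer (auto simp: algebra_simps)
  show "a *\<^sub>R b *\<^sub>R x = (a * b) *\<^sub>R x" by transfer auto
  show "1 *\<^sub>R x = x" by transfer auto
  show "dist x y = norm (x - y)" by (fact dist_ell1_def)
  show "sgn x = inverse (norm x) *\<^sub>R x" by (fact sgn_ell1_def)
  show "uniformity = (INF e\<in>{0<..}. principal {(x :: ell1, y). dist x y < e})"
    by (fact uniformity_ell1_def)
  show "open U \<longleftrightarrow> (\<forall>x\<in>U. eventually (\<lambda>(x', y). x' = x \<longrightarrow> y \<in> U) uniformity)"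
    by (fact open_ell1_def)
  show "norm x = 0 \<longleftrightarrow> x = 0"
    by transfer (simp add: suminf_eq_zero_iff fun_eq_iff)
  show "norm (a *\<^sub>R x) = \<bar>a\<bar> * norm x"
    by transfer (simp add: abs_mult suminf_mult)
  show "norm (x + y) \<le> norm x + norm y"
  proof transfer
    fix x y :: "nat \<Rightarrow> real"
    assume *: "summable (\<lambda>k. \<bar>x k\<bar>)" "summable (\<lambda>k. \<bar>y k\<bar>)"
    then have s: "summable (\<lambda>k. \<bar>x k\<bar> + \<bar>y k\<bar>)" by (rule summable_add)
    then have "summable (\<lambda>k. \<bar>x k + y k\<bar>)"
      by (rule summable_comparison_test'[where N = 0]) auto
    then have "(\<Sum>k. \<bar>x k + y k\<bar>) \<le> (\<Sum>k. \<bar>x k\<bar> + \<bar>y k\<bar>)"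
      using s by (intro suminf_le) auto
    then show "(\<Sum>k. \<bar>x k + y k\<bar>) \<le> (\<Sum>k. \<bar>x k\<bar>) + (\<Sum>k. \<bar>y k\<bar>)"
      using suminf_add[OF *] by simp
  qed
qed

end

lemma ell1_nth_minus: "ell1_nth (x - y) k = ell1_nth x k - ell1_nth y k"
  unfolding minus_ell1_def by transfer simp

lemma sum_le_norm_ell1: "(\<Sum>k<K. \<bar>ell1_nth x k\<bar>) \<le> norm x"
  by transfer (rule sum_le_suminf, auto)

lemma abs_ell1_nth_le: "\<bar>ell1_nth x k\<bar> \<le> norm x"
proof -
  have "\<bar>ell1_nth x k\<bar> \<le> (\<Sum>i<Suc k. \<bar>ell1_nth x i\<bar>)" by (simp add: sum_nonneg)
  then show ?thesis using sum_le_norm_ell1[of x "Suc k"] by linarith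
qed

instance ell1 :: banach
proof
  fix X :: "nat \<Rightarrow> ell1"
  assume X: "Cauchy X"
  define f where "f n = ell1_nth (X n)" for n
  have "Cauchy (\<lambda>n. f n k)" for k
  proof (rule metric_CauchyI)
    fix e :: real assume "e > 0"
    then obtain M where M: "\<forall>m\<ge>M. \<forall>n\<ge>M. dist (X m) (X n) < e"
      using X unfolding Cauchy_def by blast
    have "dist (f m k) (f n k) \<le> dist (X m) (X n)" for m n
      using abs_ell1_nth_le[of "X m - X n" k]
      by (simp add: dist_real_def dist_norm f_def ell1_nth_minus)
    then show "\<exists>M. \<forall>m\<ge>M. \<forall>n\<ge>M. dist (f m k) (f n k) < e"
      using M by (meson le_less_trans)
  qed
  then have "\<exists>l. (\<lambda>n. f n k) \<longlonglongrightarrow> l" for k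
    using Cauchy_convergent convergent_def by blast
  then obtain l where l: "\<And>k. (\<lambda>n. f n k) \<longlonglongrightarrow> l k" by metis
  have bd: "\<exists>N. \<forall>m\<ge>N. \<forall>K. (\<Sum>k<K. \<bar>f m k - l k\<bar>) \<le> e" if e: "e > 0" for e
  proof -
    obtain N where N: "\<And>m n. m \<ge> N \<Longrightarrow> n \<ge> N \<Longrightarrow> dist (X m) (X n) < e"
      using X e unfolding Cauchy_def by blast
    have "(\<Sum>k<K. \<bar>f m k - l k\<bar>) \<le> e" if m: "m \<ge> N" for m K
    proof (rule LIMSEQ_le_const2)
      show "(\<lambda>n. \<Sum>k<K. \<bar>f m k - f n k\<bar>) \<longlonglongrightarrow> (\<Sum>k<K. \<bar>f m k - l k\<bar>)"
        by (intro tendsto_intros l)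
      have "(\<Sum>k<K. \<bar>f m k - f n k\<bar>) \<le> e" if "n \<ge> N" for n
        using sum_le_norm_ell1[of "X m - X n" K] N[OF m that]
        by (simp add: f_def ell1_nth_minus dist_norm)
      then show "\<exists>M. \<forall>n\<ge>M. (\<Sum>k<K. \<bar>f m k - f n k\<bar>) \<le> e" by blast
    qed
    then show ?thesis by blast
  qed
  obtain N where "\<And>K. (\<Sum>k<K. \<bar>f N k - l k\<bar>) \<le> 1" using bd[of 1] by auto
  then have "summable (\<lambda>k. \<bar>f N k - l k\<bar>)" by (intro summableI_nonneg_bounded) auto
  then have "summable (\<lambda>k. \<bar>f N k - l k\<bar> + \<bar>f N k\<bar>)"
    using summable_ell1_nth unfolding f_def by (rule summable_add)
  then have "summable (\<lambda>k. \<bar>l k\<bar>)"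
    by (rule summable_comparison_test'[where N = 0]) auto
  then have nth: "ell1_nth (Abs_ell1 l) = l" by (simp add: Abs_ell1_inverse)
  have "X \<longlonglongrightarrow> Abs_ell1 l"
  proof (rule LIMSEQ_I)
    fix e :: real assume "e > 0"
    then obtain N where N: "\<forall>m\<ge>N. \<forall>K. (\<Sum>k<K. \<bar>f m k - l k\<bar>) \<le> e / 2"
      using bd[of "e / 2"] by auto
    have "norm (X m - Abs_ell1 l) \<le> e / 2" if "m \<ge> N" for m
    proof -
      have "(\<Sum>k. \<bar>ell1_nth (X m - Abs_ell1 l) k\<bar>) \<le> e / 2"
        using N that
        by (intro suminf_le_const summable_ell1_nth) (auto simp: ell1_nth_minus nth f_def)
      then show ?thesis by (simp add: norm_ell1.rep_eq)
    qed
    then show "\<exists>N. \<forall>m\<ge>N. norm (X m - Abs_ell1 l) < e"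
      using \<open>e > 0\<close> by (intro exI[of _ N]) force
  qed
  then show "convergent X" by (rule convergentI)
qed

section \<open>The space of square summable sequences\<close>

typedef ell2 = "{x :: nat \<Rightarrow> real. summable (\<lambda>k. (x k)\<^sup>2)}"
  morphisms ell2_nth Abs_ell2
  by (rule exI[of _ "\<lambda>_. 0"]) simp

setup_lifting type_definition_ell2

lemma summable_ell2_nth: "summable (\<lambda>k. (ell2_nth x k)\<^sup>2)"
  using ell2_nth[of x] by simp

lemma summable_mult_of_squares:
  fixes x y :: "nat \<Rightarrow> real"
  assumes "summable (\<lambda>k. (x k)\<^sup>2)" "summable (\<lambda>k. (y k)\<^sup>2)"
  shows "summable (\<lambda>k. x k * y k)"
proof (rule summable_comparison_test'[where N = 0])
  show "summable (\<lambda>k. (x k)\<^sup>2 + (y k)\<^sup>2)" using assms by (rule summable_add)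
  show "norm (x n * y n) \<le> (x n)\<^sup>2 + (y n)\<^sup>2" for n
  proof -
    have "2 * \<bar>x n\<bar> * \<bar>y n\<bar> \<le> (x n)\<^sup>2 + (y n)\<^sup>2"
      using sum_squares_bound[of "\<bar>x n\<bar>" "\<bar>y n\<bar>"] by simp
    moreover have "0 \<le> \<bar>x n\<bar> * \<bar>y n\<bar>" by simp
    ultimately have "\<bar>x n\<bar> * \<bar>y n\<bar> \<le> (x n)\<^sup>2 + (y n)\<^sup>2" by linarith
    then show ?thesis by (simp add: abs_mult)
  qed
qed

instantiation ell2 :: real_inner
begin

lift_definition zero_ell2 :: ell2 is "\<lambda>_. 0" by simp

lift_definition plus_ell2 :: "ell2 \<Rightarrow> ell2 \<Rightarrow> ell2" is "\<lambda>x y k. x k + y k"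
proof -
  fix x y :: "nat \<Rightarrow> real"
  assume *: "summable (\<lambda>k. (x k)\<^sup>2)" "summable (\<lambda>k. (y k)\<^sup>2)"
  have "summable (\<lambda>k. (x k)\<^sup>2 + (y k)\<^sup>2 + 2 * (x k * y k))"
    by (intro summable_add summable_mult summable_mult_of_squares *)
  then show "summable (\<lambda>k. (x k + y k)\<^sup>2)" by (simp add: power2_sum mult.assoc)
qed

lift_definition uminus_ell2 :: "ell2 \<Rightarrow> ell2" is "\<lambda>x k. - x k" by simp

lift_definition scaleR_ell2 :: "real \<Rightarrow> ell2 \<Rightarrow> ell2" is "\<lambda>r x k. r * x k"
  by (simp add: power_mult_distrib summable_mult)

lift_definition inner_ell2 :: "ell2 \<Rightarrow> ell2 \<Rightarrow> real" is "\<lambda>x y. \<Sum>k. x k * y k" .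

definition norm_ell2 :: "ell2 \<Rightarrow> real" where "norm x = sqrt (inner x (x :: ell2))"
definition minus_ell2 :: "ell2 \<Rightarrow> ell2 \<Rightarrow> ell2" where "x - y = x + - (y :: ell2)"
definition dist_ell2 :: "ell2 \<Rightarrow> ell2 \<Rightarrow> real" where "dist x y = norm (x - y :: ell2)"
definition sgn_ell2 :: "ell2 \<Rightarrow> ell2" where "sgn x = inverse (norm x) *\<^sub>R (x :: ell2)"
definition uniformity_ell2 :: "(ell2 \<times> ell2) filter"
  where "uniformity_ell2 = (INF e\<in>{0<..}. principal {(x, y). dist x y < e})"
definition open_ell2 :: "ell2 set \<Rightarrow> bool"
  where "open_ell2 U \<longleftrightarrow> (\<forall>x\<in>U. eventually (\<lambda>(x', y). x' = x \<longrightarrow> y \<in> U) uniformity)"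

instance
proof
  fix x y z :: ell2 and a b :: real and U :: "ell2 set"
  show "x + y + z = x + (y + z)" by transfer auto
  show "x + y = y + x" by transfer auto
  show "0 + x = x" by transfer auto
  show "- x + x = 0" by transfer auto
  show "x - y = x + - y" by (fact minus_ell2_def)
  show "a *\<^sub>R (x + y) = a *\<^sub>R x + a *\<^sub>R y" by transfer (auto simp: algebra_simps)
  show "(a + b) *\<^sub>R x = a *\<^sub>R x + b *\<^sub>R x" by transfer (auto simp: algebra_simps)
  show "a *\<^sub>R b *\<^sub>R x = (a * b) *\<^sub>R x" by transfer auto
  show "1 *\<^sub>R x = x" by transfer auto
  show "dist x y = norm (x - y)" by (fact dist_ell2_def)
  show "sgn x = inverse (norm x) *\<^sub>R x" by (fact sgn_ell2_def)
  show "uniformity = (INF e\<in>{0<..}. principal {(x :: ell2, y). dist x y < e})"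
    by (fact uniformity_ell2_def)
  show "open U \<longleftrightarrow> (\<forall>x\<in>U. eventually (\<lambda>(x', y). x' = x \<longrightarrow> y \<in> U) uniformity)"
    by (fact open_ell2_def)
  show "norm x = sqrt (inner x x)" by (fact norm_ell2_def)
  show "inner x y = inner y x" by transfer (simp add: mult.commute)
  show "inner (x + y) z = inner x z + inner y z"
    by transfer (simp add: distrib_right suminf_add summable_mult_of_squares)
  show "inner (a *\<^sub>R x) y = a * inner x y"
    by transfer (simp add: mult.assoc suminf_mult summable_mult_of_squares)
  show "0 \<le> inner x x"
    by transfer (simp add: power2_eq_square suminf_nonneg)
  show "inner x x = 0 \<longleftrightarrow> x = 0"
    by transfer (simp add: power2_eq_square suminf_eq_zero_iff fun_eq_iff)
qed

end

lemma ell2_nth_minus: "ell2_nth (x - y) k = ell2_nth x k - ell2_nth y k"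
  unfolding minus_ell2_def by transfer simp

lemma norm_ell2_sq: "(norm x)\<^sup>2 = (\<Sum>k. (ell2_nth x k)\<^sup>2)"
  unfolding power2_norm_eq_inner by transfer (simp add: power2_eq_square)

lemma sum_le_norm_ell2: "(\<Sum>k<K. (ell2_nth x k)\<^sup>2) \<le> (norm x)\<^sup>2"
  unfolding norm_ell2_sq by (rule sum_le_suminf) (auto intro: summable_ell2_nth)

lemma abs_ell2_nth_le: "\<bar>ell2_nth x k\<bar> \<le> norm x"
proof (rule power2_le_imp_le)
  have "(ell2_nth x k)\<^sup>2 \<le> (\<Sum>i<Suc k. (ell2_nth x i)\<^sup>2)" by (simp add: sum_nonneg)
  then show "\<bar>ell2_nth x k\<bar>\<^sup>2 \<le> (norm x)\<^sup>2"
    using sum_le_norm_ell2[of x "Suc k"] unfolding power2_abs by linarith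
qed simp

instance ell2 :: banach
proof
  fix X :: "nat \<Rightarrow> ell2"
  assume X: "Cauchy X"
  define f where "f n = ell2_nth (X n)" for n
  have "Cauchy (\<lambda>n. f n k)" for k
  proof (rule metric_CauchyI)
    fix e :: real assume "e > 0"
    then obtain M where M: "\<forall>m\<ge>M. \<forall>n\<ge>M. dist (X m) (X n) < e"
      using X unfolding Cauchy_def by blast
    have "dist (f m k) (f n k) \<le> dist (X m) (X n)" for m n
      using abs_ell2_nth_le[of "X m - X n" k]
      by (simp add: dist_real_def dist_norm f_def ell2_nth_minus)
    then show "\<exists>M. \<forall>m\<ge>M. \<forall>n\<ge>M. dist (f m k) (f n k) < e"
      using M by (meson le_less_trans)
  qed
  then have "\<exists>l. (\<lambda>n. f n k) \<longlonglongrightarrow> l" for k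
    using Cauchy_convergent convergent_def by blast
  then obtain l where l: "\<And>k. (\<lambda>n. f n k) \<longlonglongrightarrow> l k" by metis
  have bd: "\<exists>N. \<forall>m\<ge>N. \<forall>K. (\<Sum>k<K. (f m k - l k)\<^sup>2) \<le> e\<^sup>2" if e: "e > 0" for e
  proof -
    obtain N where N: "\<And>m n. m \<ge> N \<Longrightarrow> n \<ge> N \<Longrightarrow> dist (X m) (X n) < e"
      using X e unfolding Cauchy_def by blast
    have "(\<Sum>k<K. (f m k - l k)\<^sup>2) \<le> e\<^sup>2" if m: "m \<ge> N" for m K
    proof (rule LIMSEQ_le_const2)
      show "(\<lambda>n. \<Sum>k<K. (f m k - f n k)\<^sup>2) \<longlonglongrightarrow> (\<Sum>k<K. (f m k - l k)\<^sup>2)"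
        by (intro tendsto_intros l)
      have "(\<Sum>k<K. (f m k - f n k)\<^sup>2) \<le> e\<^sup>2" if "n \<ge> N" for n
      proof -
        have "(norm (X m - X n))\<^sup>2 \<le> e\<^sup>2"
          using N[OF m that] by (intro power_mono) (auto simp: dist_norm)
        then show ?thesis
          using sum_le_norm_ell2[of "X m - X n" K] by (simp add: f_def ell2_nth_minus)
      qed
      then show "\<exists>M. \<forall>n\<ge>M. (\<Sum>k<K. (f m k - f n k)\<^sup>2) \<le> e\<^sup>2" by blast
    qed
    then show ?thesis by blast
  qed
  obtain N where "\<And>K. (\<Sum>k<K. (f N k - l k)\<^sup>2) \<le> 1" using bd[of 1] by auto
  then have "summable (\<lambda>k. (f N k - l k)\<^sup>2)" by (intro summableI_nonneg_bounded) auto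
  then have "ell2_nth (X N - Abs_ell2 (\<lambda>k. f N k - l k)) = l"
    by (simp add: fun_eq_iff ell2_nth_minus Abs_ell2_inverse f_def)
  then have nth: "ell2_nth (Abs_ell2 l) = l"
    by (metis ell2_nth_inverse)
  have "X \<longlonglongrightarrow> Abs_ell2 l"
  proof (rule LIMSEQ_I)
    fix e :: real assume "e > 0"
    then obtain N where N: "\<forall>m\<ge>N. \<forall>K. (\<Sum>k<K. (f m k - l k)\<^sup>2) \<le> (e / 2)\<^sup>2"
      using bd[of "e / 2"] by auto
    have "norm (X m - Abs_ell2 l) \<le> e / 2" if "m \<ge> N" for m
    proof (rule power2_le_imp_le)
      show "(norm (X m - Abs_ell2 l))\<^sup>2 \<le> (e / 2)\<^sup>2"
        unfolding norm_ell2_sq using N that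
        by (intro suminf_le_const summable_ell2_nth) (auto simp: ell2_nth_minus nth f_def)
    qed (use \<open>e > 0\<close> in simp)
    then show "\<exists>N. \<forall>m\<ge>N. norm (X m - Abs_ell2 l) < e"
      using \<open>e > 0\<close> by (intro exI[of _ N]) force
  qed
  then show "convergent X" by (rule convergentI)
qed

section \<open>Weak and weak* topologies\<close>

text \<open>The coarsest topology on the whole type that makes all functionals in \<open>F\<close> continuous.\<close>

definition initial_topology :: "('a \<Rightarrow> real) set \<Rightarrow> 'a topology" where
  "initial_topology F = topology_generated_by {f -` V |f V. f \<in> F \<and> open V}"

definition weak_topology :: "'a::real_normed_vector topology" where
  "weak_topology = initial_topology {f. bounded_linear f}"

definition c0 :: "(nat \<Rightarrow> real) set" where
  "c0 = {c. c \<longlonglongrightarrow> 0}"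

definition ell1_c0_pairing :: "ell1 \<Rightarrow> (nat \<Rightarrow> real) \<Rightarrow> real" where
  "ell1_c0_pairing x c = (\<Sum>k. ell1_nth x k * c k)"

definition weak_star_topology :: "ell1 topology" where
  "weak_star_topology = initial_topology {\<lambda>x. ell1_c0_pairing x c |c. c \<in> c0}"

lemma summable_ell1_c0_pairing:
  assumes "c \<in> c0"
  shows "summable (\<lambda>k. ell1_nth x k * c k)"
proof -
  have "Bseq c" using assms by (auto simp: c0_def intro: convergent_imp_Bseq convergentI)
  then obtain K where K: "\<And>k. \<bar>c k\<bar> \<le> K" by (auto simp: Bseq_def)
  show ?thesis
  proof (rule summable_comparison_test'[where N = 0])
    show "summable (\<lambda>k. \<bar>ell1_nth x k\<bar> * K)"
      by (intro summable_mult2 summable_ell1_nth)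
    show "norm (ell1_nth x n * c n) \<le> \<bar>ell1_nth x n\<bar> * K" for n
      using K[of n] by (simp add: abs_mult mult_left_mono)
  qed
qed

lemma limitin_initial_topology:
  assumes "F \<noteq> {}"
  shows "limitin (initial_topology F) x a G \<longleftrightarrow> (\<forall>f\<in>F. ((\<lambda>i. f (x i)) \<longlongrightarrow> f a) G)"
    (is "?L \<longleftrightarrow> ?R")
proof
  assume L: ?L
  show ?R
  proof (intro ballI topological_tendstoI)
    fix f V assume "f \<in> F" "open V" "f a \<in> V"
    then have "openin (initial_topology F) (f -` V)" "a \<in> f -` V"
      unfolding initial_topology_def by (auto intro!: topology_generated_by_Basis)
    then show "\<forall>\<^sub>F i in G. f (x i) \<in> V"
      using L unfolding limitin_def by (auto elim!: eventually_mono)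
  qed
next
  assume R: ?R
  have ev: "a \<in> S \<longrightarrow> (\<forall>\<^sub>F i in G. x i \<in> S)"
    if "generate_topology_on {f -` V |f V. f \<in> F \<and> open V} S" for S
    using that
  proof induction
    case (UN K)
    then show ?case by (fastforce elim: eventually_mono)
  next
    case (Basis S)
    then obtain f V where S: "S = f -` V" "f \<in> F" "open V" by blast
    show ?case
    proof
      assume "a \<in> S"
      then have "\<forall>\<^sub>F i in G. f (x i) \<in> V"
        using R S by (intro topological_tendstoD[of _ "f a"]) auto
      then show "\<forall>\<^sub>F i in G. x i \<in> S" by (simp add: S)
    qed
  qed (auto intro: eventually_conj)
  have "a \<in> topspace (initial_topology F)"
    using assms by (auto simp: initial_topology_def intro!: exI[of _ UNIV])
  then show ?L
    using ev unfolding limitin_def initial_topology_def openin_topology_generated_by_iff by blast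
qed

lemma limitin_weak_star:
  "limitin weak_star_topology x a G \<longleftrightarrow>
    (\<forall>c\<in>c0. ((\<lambda>i. ell1_c0_pairing (x i) c) \<longlongrightarrow> ell1_c0_pairing a c) G)"
proof -
  have "(\<lambda>_. 0) \<in> c0" by (simp add: c0_def)
  then show ?thesis
    unfolding weak_star_topology_def by (subst limitin_initial_topology) auto
qed

lemma limitin_weak:
  "limitin weak_topology x a G \<longleftrightarrow>
    (\<forall>f. bounded_linear f \<longrightarrow> ((\<lambda>i. f (x i) :: real) \<longlongrightarrow> f a) G)"
  unfolding weak_topology_def
  by (subst limitin_initial_topology) (auto intro: bounded_linear_zero)

section \<open>The operator induced by a sequence of unit vectors of \<open>\<ell>\<^sup>2\<close>\<close>

lemma
  fixes \<zeta> :: "nat \<Rightarrow> ell2"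
  assumes "\<And>k. \<zeta> k \<in> sphere 0 1"
  shows summable_synthesis: "summable (\<lambda>k. ell1_nth x k *\<^sub>R \<zeta> k)"
    and bounded_linear_synthesis: "bounded_linear (\<lambda>x. \<Sum>k. ell1_nth x k *\<^sub>R \<zeta> k)"
proof -
  have n: "norm (ell1_nth x k *\<^sub>R \<zeta> k) = \<bar>ell1_nth x k\<bar>" for x k
    using assms[of k] by simp
  then have sn: "summable (\<lambda>k. norm (ell1_nth x k *\<^sub>R \<zeta> k))" for x
    by (simp only: summable_ell1_nth)
  then have s: "summable (\<lambda>k. ell1_nth x k *\<^sub>R \<zeta> k)" for x
    by (rule summable_norm_cancel)
  then show "summable (\<lambda>k. ell1_nth x k *\<^sub>R \<zeta> k)" .
  let ?B = "\<lambda>x. \<Sum>k. ell1_nth x k *\<^sub>R \<zeta> k"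
  show "bounded_linear ?B"
  proof (rule bounded_linear_intro[where K = 1])
    show "?B (x + y) = ?B x + ?B y" for x y
      by (subst suminf_add) (use s in \<open>auto simp: plus_ell1.rep_eq scaleR_left_distrib\<close>)
    show "?B (r *\<^sub>R x) = r *\<^sub>R ?B x" for r x
      using bounded_linear.suminf[OF bounded_linear_scaleR_right[of r] s[of x]]
      by (simp add: scaleR_ell1.rep_eq)
    show "norm (?B x) \<le> norm x * 1" for x
      using summable_norm[OF sn, of x] by (simp add: n norm_ell1.rep_eq del: norm_scaleR)
  qed
qed

definition finite_dimensional :: "'a::real_vector set \<Rightarrow> bool" where
  "finite_dimensional U \<longleftrightarrow> (\<exists>S. finite S \<and> span S = U)"

end

theory Submission
  imports Defs
begin

text \<open>
  Write \<open>e\<^sub>n\<close> for the unit vectors. Density provides indices \<open>\<kappa> n\<close> with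
  \<open>norm (e\<^sub>n - \<zeta> (\<kappa> n)) \<le> \<delta>\<^sub>n\<close>, where \<open>\<Sum>\<delta>\<^sub>n = 1/2\<close>. Let \<open>U\<close> be the space of all
  \<open>x \<in> \<ell>\<^sup>1\<close> supported on the range of \<open>\<kappa>\<close>; since \<open>\<kappa>\<close> is injective, \<open>U\<close> is a copy of \<open>\<ell>\<^sup>1\<close>.
  On \<open>U\<close> the operator \<open>B\<close> acts as \<open>t \<mapsto> \<Sum>t\<^sub>n \<zeta> (\<kappa> n)\<close>, and the vectors \<open>\<zeta> (\<kappa> n)\<close> are a small
  perturbation of the orthonormal basis.

  The perturbation is small enough that every \<open>w \<in> \<ell>\<^sup>2\<close> has a unique expansion
  \<open>w = \<Sum>a\<^sub>n \<zeta> (\<kappa> n)\<close> with \<open>a \<in> \<ell>\<^sup>2\<close> (lemma \<open>perturbed_unit_vectors_expansion\<close>). Uniqueness makes \<open>B\<close>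
  injective on \<open>U\<close>; truncating the expansion makes its range dense.

  For the continuity, let \<open>f\<close> be a bounded functional on \<open>\<ell>\<^sup>2\<close>. Since \<open>e\<^sub>n\<close> is weakly null, so is
  \<open>\<zeta> (\<kappa> n)\<close>, whose distance to \<open>e\<^sub>n\<close> tends to zero. The values \<open>f (\<zeta> (\<kappa> n))\<close>, placed at the positions \<open>\<kappa> n\<close> and
  extended by zero, form an element of \<open>c\<^sub>0\<close>. On \<open>U\<close> this element represents \<open>f \<circ> B\<close>.
\<close>

section \<open>Unit vectors\<close>

lift_definition ell1_unit :: "nat \<Rightarrow> ell1" is "\<lambda>n k. if k = n then 1 else 0"
  by (rule summable_finite[of "{n}" for n]) auto

lift_definition ell2_unit :: "nat \<Rightarrow> ell2" is "\<lambda>n k. if k = n then 1 else 0"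
  by (rule summable_finite[of "{n}" for n]) auto

lemma ell1_eqI: "(\<And>k. ell1_nth x k = ell1_nth y k) \<Longrightarrow> x = y"
  by (simp add: ell1_nth_inject[symmetric] fun_eq_iff)

lemma ell2_eqI: "(\<And>k. ell2_nth x k = ell2_nth y k) \<Longrightarrow> x = y"
  by (simp add: ell2_nth_inject[symmetric] fun_eq_iff)

lemma bounded_linear_ell1_nth: "bounded_linear (\<lambda>x. ell1_nth x k)"
  by (rule bounded_linear_intro[where K = 1])
    (auto simp: plus_ell1.rep_eq scaleR_ell1.rep_eq abs_ell1_nth_le)

lemma bounded_linear_ell2_nth: "bounded_linear (\<lambda>x. ell2_nth x k)"
  by (rule bounded_linear_intro[where K = 1])
    (auto simp: plus_ell2.rep_eq scaleR_ell2.rep_eq abs_ell2_nth_le)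

lemma norm_ell1_unit: "norm (ell1_unit n) = 1"
proof -
  have "(\<Sum>k. \<bar>if k = n then 1 else 0 :: real\<bar>) = (\<Sum>k\<in>{n}. \<bar>if k = n then 1 else 0\<bar>)"
    by (rule suminf_finite) auto
  then show ?thesis by (simp add: norm_ell1.rep_eq ell1_unit.rep_eq)
qed

lemma norm_ell2_unit: "norm (ell2_unit n) = 1"
proof -
  have "(\<Sum>k. (if k = n then 1 else 0 :: real)\<^sup>2) = (\<Sum>k\<in>{n}. (if k = n then 1 else 0)\<^sup>2)"
    by (rule suminf_finite) auto
  then have "(norm (ell2_unit n))\<^sup>2 = 1\<^sup>2" by (simp add: norm_ell2_sq ell2_unit.rep_eq)
  then show ?thesis by (rule power2_eq_imp_eq) auto
qed

lemma sum_ell2_unit_nth: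
  "ell2_nth (\<Sum>n<N. a n *\<^sub>R ell2_unit n) k = (if k < N then a k else 0)"
proof -
  have "ell2_nth (\<Sum>n<N. a n *\<^sub>R ell2_unit n) k = (\<Sum>n<N. ell2_nth (a n *\<^sub>R ell2_unit n) k)"
    by (rule linear_sum[OF bounded_linear.linear[OF bounded_linear_ell2_nth]])
  also have "\<dots> = (\<Sum>n<N. if k = n then a n else 0)"
    by (intro sum.cong) (auto simp: scaleR_ell2.rep_eq ell2_unit.rep_eq)
  finally show ?thesis by simp
qed

lemma norm_sum_ell2_unit_sq: "(norm (\<Sum>n<N. a n *\<^sub>R ell2_unit n))\<^sup>2 = (\<Sum>n<N. (a n)\<^sup>2)"
proof -
  have "(\<Sum>k. (if k < N then a k else 0)\<^sup>2) = (\<Sum>k<N. (if k < N then a k else 0)\<^sup>2)"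
    by (rule suminf_finite) auto
  then show ?thesis by (simp add: norm_ell2_sq sum_ell2_unit_nth)
qed

lemma ell2_unit_expansion: "(\<lambda>n. ell2_nth a n *\<^sub>R ell2_unit n) sums a"
proof -
  let ?r = "\<lambda>N. a - (\<Sum>n<N. ell2_nth a n *\<^sub>R ell2_unit n)"
  have "(norm (?r N))\<^sup>2 = (\<Sum>k. (ell2_nth a k)\<^sup>2) - (\<Sum>k<N. (ell2_nth a k)\<^sup>2)" for N
  proof -
    have "(norm (?r N))\<^sup>2 = (\<Sum>k. if k < N then 0 else (ell2_nth a k)\<^sup>2)"
      unfolding norm_ell2_sq
      by (rule suminf_cong) (auto simp: ell2_nth_minus sum_ell2_unit_nth)
    also have "\<dots> = (\<Sum>k. (ell2_nth a k)\<^sup>2 - (if k < N then (ell2_nth a k)\<^sup>2 else 0))"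
      by (rule suminf_cong) auto
    also have "\<dots> = (\<Sum>k. (ell2_nth a k)\<^sup>2) - (\<Sum>k. if k < N then (ell2_nth a k)\<^sup>2 else 0)"
      by (rule suminf_diff[symmetric])
        (auto intro: summable_ell2_nth summable_finite[of "{..<N}"])
    also have "(\<Sum>k. if k < N then (ell2_nth a k)\<^sup>2 else 0)
        = (\<Sum>k<N. if k < N then (ell2_nth a k)\<^sup>2 else 0)"
      by (rule suminf_finite) auto
    finally show ?thesis by simp
  qed
  moreover have "(\<lambda>N. (\<Sum>k. (ell2_nth a k)\<^sup>2) - (\<Sum>k<N. (ell2_nth a k)\<^sup>2))
      \<longlonglongrightarrow> (\<Sum>k. (ell2_nth a k)\<^sup>2) - (\<Sum>k. (ell2_nth a k)\<^sup>2)"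
    by (intro tendsto_intros summable_LIMSEQ summable_ell2_nth)
  ultimately have "(\<lambda>N. (norm (?r N))\<^sup>2) \<longlonglongrightarrow> 0" by simp
  then have "(\<lambda>N. sqrt ((norm (?r N))\<^sup>2)) \<longlonglongrightarrow> sqrt 0" by (rule tendsto_real_sqrt)
  then have "?r \<longlonglongrightarrow> 0" by (simp add: tendsto_norm_zero_iff)
  from tendsto_diff[OF tendsto_const[of a] this] show ?thesis by (simp add: sums_def)
qed

text \<open>
  The vector \<open>v = \<Sum>f(e\<^sub>n) e\<^sub>n\<close>, summed over \<open>n < N\<close>, satisfies \<open>f v = (norm v)\<^sup>2\<close>. Hence a
  bound \<open>K\<close> for \<open>f\<close> also bounds \<open>norm v\<close>, and \<open>\<Sum>f(e\<^sub>n)\<^sup>2\<close> converges.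
\<close>

lemma ell2_unit_weakly_null:
  fixes f :: "ell2 \<Rightarrow> real"
  assumes "bounded_linear f"
  shows "(\<lambda>n. f (ell2_unit n)) \<longlonglongrightarrow> 0"
proof -
  interpret f: bounded_linear f by fact
  obtain K where K: "K > 0" "\<And>x. norm (f x) \<le> norm x * K" using f.pos_bounded by auto
  have "(\<Sum>n<N. (f (ell2_unit n))\<^sup>2) \<le> K\<^sup>2" for N
  proof -
    define v where "v = (\<Sum>n<N. f (ell2_unit n) *\<^sub>R ell2_unit n)"
    have sq: "(norm v)\<^sup>2 = (\<Sum>n<N. (f (ell2_unit n))\<^sup>2)"
      by (simp add: v_def norm_sum_ell2_unit_sq)
    have "f v = (norm v)\<^sup>2"
      unfolding sq by (simp add: v_def f.sum f.scale power2_eq_square)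
    then have "norm v * norm v \<le> norm v * K"
      using K(2)[of v] by (simp add: power2_eq_square)
    then have "norm v \<le> K"
      using K(1) by (cases "norm v = 0") auto
    then show ?thesis unfolding sq[symmetric] by (intro power_mono) auto
  qed
  then have "summable (\<lambda>n. (f (ell2_unit n))\<^sup>2)" by (intro summableI_nonneg_bounded) auto
  then have "(\<lambda>n. (f (ell2_unit n))\<^sup>2) \<longlonglongrightarrow> 0" by (rule summable_LIMSEQ_zero)
  then have "(\<lambda>n. sqrt ((f (ell2_unit n))\<^sup>2)) \<longlonglongrightarrow> sqrt 0" by (rule tendsto_real_sqrt)
  then show ?thesis by (simp add: tendsto_rabs_zero_iff)
qed

section \<open>Small perturbations of the orthonormal basis\<close>

text \<open>
  With \<open>P a = \<Sum>a\<^sub>n (e\<^sub>n - \<xi>\<^sub>n)\<close>, the series \<open>\<Sum>a\<^sub>n \<xi>\<^sub>n\<close> has sum \<open>a - P a\<close>. The operator \<open>P\<close> has norm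
  at most \<open>\<Sum>\<delta>\<^sub>n < 1\<close>, so the coefficient sequences of \<open>w\<close> are the fixed points of the contraction
  \<open>a \<mapsto> w + P a\<close>.
\<close>

lemma perturbed_unit_vectors_expansion:
  fixes \<xi> :: "nat \<Rightarrow> ell2"
  assumes \<delta>: "\<And>n. norm (ell2_unit n - \<xi> n) \<le> \<delta> n"
    and sm: "summable \<delta>" and lt1: "suminf \<delta> < 1"
  shows "\<exists>!a. (\<lambda>n. ell2_nth a n *\<^sub>R \<xi> n) sums w"
proof -
  define P where "P a = (\<Sum>n. ell2_nth a n *\<^sub>R (ell2_unit n - \<xi> n))" for a
  have nle: "norm (ell2_nth a n *\<^sub>R (ell2_unit n - \<xi> n)) \<le> norm a * \<delta> n" for a n
    using mult_mono[OF abs_ell2_nth_le \<delta>, of a n n] by simp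
  have sn: "summable (\<lambda>n. norm (ell2_nth a n *\<^sub>R (ell2_unit n - \<xi> n)))" for a
    by (rule summable_comparison_test'[where N = 0, OF summable_mult[OF sm, of "norm a"]])
      (simp only: real_norm_def abs_norm_cancel nle)
  have sP: "(\<lambda>n. ell2_nth a n *\<^sub>R (ell2_unit n - \<xi> n)) sums P a" for a
    unfolding P_def by (rule summable_sums[OF summable_norm_cancel[OF sn]])
  have norm_P: "norm (P a) \<le> suminf \<delta> * norm a" for a
  proof -
    have "norm (P a) \<le> (\<Sum>n. norm (ell2_nth a n *\<^sub>R (ell2_unit n - \<xi> n)))"
      unfolding P_def by (rule summable_norm[OF sn])
    also have "\<dots> \<le> (\<Sum>n. norm a * \<delta> n)"
      by (intro suminf_le nle sn summable_mult sm)
    finally show ?thesis by (simp add: suminf_mult[OF sm] mult.commute)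
  qed
  have P_diff: "P a - P b = P (a - b)" for a b
  proof (rule sums_unique2[OF _ sP])
    show "(\<lambda>n. ell2_nth (a - b) n *\<^sub>R (ell2_unit n - \<xi> n)) sums (P a - P b)"
      using sums_diff[OF sP sP, of a b] by (simp add: ell2_nth_minus scaleR_left_diff_distrib)
  qed
  have sums_\<xi>: "(\<lambda>n. ell2_nth a n *\<^sub>R \<xi> n) sums (a - P a)" for a
    using sums_diff[OF ell2_unit_expansion sP, of a a] by (simp add: scaleR_right_diff_distrib)
  have fixed: "(\<lambda>n. ell2_nth a n *\<^sub>R \<xi> n) sums w \<longleftrightarrow> w + P a = a" for a
  proof -
    have "(\<lambda>n. ell2_nth a n *\<^sub>R \<xi> n) sums w \<longleftrightarrow> a - P a = w"
      using sums_\<xi>[of a] sums_unique2 by blast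
    then show ?thesis by (auto simp: algebra_simps)
  qed
  have nonneg: "0 \<le> suminf \<delta>"
    by (rule suminf_nonneg[OF sm order_trans[OF norm_ge_zero \<delta>]])
  show ?thesis
    unfolding fixed
    by (rule banach_fix_type[OF nonneg lt1]) (simp add: dist_norm P_diff norm_P)
qed

section \<open>Summable sequences supported on the range of an injection\<close>

definition supported_on :: "nat set \<Rightarrow> ell1 set" where
  "supported_on A = {x. \<forall>k. k \<notin> A \<longrightarrow> ell1_nth x k = 0}"

lemma subspace_supported_on: "subspace (supported_on A)"
  by (auto simp: subspace_def supported_on_def zero_ell1.rep_eq plus_ell1.rep_eq scaleR_ell1.rep_eq)

lemma closed_supported_on: "closed (supported_on A)"
proof -
  have "supported_on A = (\<Inter>k\<in>-A. {x. ell1_nth x k = 0})"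
    by (auto simp: supported_on_def)
  moreover have "closed {x. ell1_nth x k = 0}" for k
    by (intro closed_Collect_eq continuous_on_const
        linear_continuous_on bounded_linear_ell1_nth)
  ultimately show ?thesis by auto
qed

lemma ell1_unit_supported_on: "n \<in> A \<Longrightarrow> ell1_unit n \<in> supported_on A"
  by (auto simp: supported_on_def ell1_unit.rep_eq)

lemma independent_ell1_unit: "independent (ell1_unit ` A)"
  unfolding dependent_def
proof clarsimp
  fix n
  assume n: "ell1_unit n \<in> span (ell1_unit ` A - {ell1_unit n})"
  have "ell1_nth (ell1_unit n) n = 0"
    by (rule linear_eq_0_on_span[OF bounded_linear.linear[OF bounded_linear_ell1_nth] _ n])
      (auto simp: ell1_unit.rep_eq)
  then show False by (simp add: ell1_unit.rep_eq)
qed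

lemma infinite_dimensional_supported_on:
  assumes "infinite A"
  shows "\<not> finite_dimensional (supported_on A)"
proof
  assume "finite_dimensional (supported_on A)"
  then obtain S where "finite S" and "span S = supported_on A"
    by (auto simp: finite_dimensional_def)
  then have "finite (ell1_unit ` A)"
    using independent_span_bound[OF _ independent_ell1_unit, of S A] ell1_unit_supported_on
    by (auto simp: image_subset_iff)
  moreover have "inj ell1_unit"
    by (rule injI) (metis ell1_unit.rep_eq zero_neq_one)
  ultimately show False
    using assms finite_imageD inj_on_subset by blast
qed

definition spread :: "(nat \<Rightarrow> nat) \<Rightarrow> ell1 \<Rightarrow> ell1" where
  "spread \<kappa> t = (\<Sum>n. ell1_nth t n *\<^sub>R ell1_unit (\<kappa> n))"

lemma summable_norm_spread: "summable (\<lambda>n. norm (ell1_nth t n *\<^sub>R ell1_unit (\<kappa> n)))"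
  by (simp add: norm_ell1_unit summable_ell1_nth)

lemma spread_sums: "(\<lambda>n. ell1_nth t n *\<^sub>R ell1_unit (\<kappa> n)) sums spread \<kappa> t"
  unfolding spread_def by (rule summable_sums[OF summable_norm_cancel[OF summable_norm_spread]])

lemma bounded_linear_spread: "bounded_linear (spread \<kappa>)"
proof (rule bounded_linear_intro[where K = 1])
  show "spread \<kappa> (x + y) = spread \<kappa> x + spread \<kappa> y" for x y
  proof (rule sums_unique2[OF spread_sums])
    show "(\<lambda>n. ell1_nth (x + y) n *\<^sub>R ell1_unit (\<kappa> n)) sums (spread \<kappa> x + spread \<kappa> y)"
      using sums_add[OF spread_sums spread_sums, of x \<kappa> y \<kappa>]
      by (simp add: plus_ell1.rep_eq scaleR_left_distrib)
  qed
  show "spread \<kappa> (r *\<^sub>R x) = r *\<^sub>R spread \<kappa> x" for r x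
  proof (rule sums_unique2[OF spread_sums])
    show "(\<lambda>n. ell1_nth (r *\<^sub>R x) n *\<^sub>R ell1_unit (\<kappa> n)) sums (r *\<^sub>R spread \<kappa> x)"
      using sums_scaleR_right[OF spread_sums, of r x \<kappa>] by (simp add: scaleR_ell1.rep_eq)
  qed
  show "norm (spread \<kappa> x) \<le> norm x * 1" for x
  proof -
    have "norm (spread \<kappa> x) \<le> (\<Sum>n. norm (ell1_nth x n *\<^sub>R ell1_unit (\<kappa> n)))"
      unfolding spread_def by (rule summable_norm[OF summable_norm_spread])
    also have "\<dots> = (\<Sum>n. \<bar>ell1_nth x n\<bar>)"
      by (simp add: norm_ell1_unit)
    finally show ?thesis by (simp add: norm_ell1.rep_eq[of x])
  qed
qed

lemma spread_nth_sums:
  "(\<lambda>n. ell1_nth t n * (if k = \<kappa> n then 1 else 0)) sums ell1_nth (spread \<kappa> t) k"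
  using bounded_linear.sums[OF bounded_linear_ell1_nth spread_sums]
  by (simp add: scaleR_ell1.rep_eq ell1_unit.rep_eq)

lemma spread_nth:
  assumes "inj \<kappa>"
  shows "ell1_nth (spread \<kappa> t) (\<kappa> m) = ell1_nth t m"
proof (rule sums_unique2[OF spread_nth_sums])
  have "ell1_nth t n * (if \<kappa> m = \<kappa> n then 1 else 0) = (if n = m then ell1_nth t n else 0)" for n
    using assms by (auto simp: inj_eq)
  then show "(\<lambda>n. ell1_nth t n * (if \<kappa> m = \<kappa> n then 1 else 0)) sums ell1_nth t m"
    using sums_single[of m "ell1_nth t"] by simp
qed

lemma spread_supported_on: "spread \<kappa> t \<in> supported_on (range \<kappa>)"
  unfolding supported_on_def
proof clarify
  fix k assume "k \<notin> range \<kappa>"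
  then have "ell1_nth t n * (if k = \<kappa> n then 1 else 0) = 0" for n by auto
  then have "(\<lambda>n. ell1_nth t n * (if k = \<kappa> n then 1 else 0)) sums 0" by (simp only: sums_zero)
  then show "ell1_nth (spread \<kappa> t) k = 0" by (rule sums_unique2[OF spread_nth_sums])
qed

definition gather :: "(nat \<Rightarrow> nat) \<Rightarrow> ell1 \<Rightarrow> ell1" where
  "gather \<kappa> x = Abs_ell1 (ell1_nth x \<circ> \<kappa>)"

lemma gather_nth:
  assumes "inj \<kappa>"
  shows "ell1_nth (gather \<kappa> x) n = ell1_nth x (\<kappa> n)"
proof -
  have "summable ((\<lambda>k. \<bar>ell1_nth x k\<bar>) \<circ> \<kappa>)"
    by (rule summable_reindex[OF summable_ell1_nth assms]) simp
  then show ?thesis by (simp add: gather_def Abs_ell1_inverse o_def)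
qed

lemma bounded_linear_gather:
  assumes "inj \<kappa>"
  shows "bounded_linear (gather \<kappa>)"
proof (rule bounded_linear_intro[where K = 1])
  show "gather \<kappa> (x + y) = gather \<kappa> x + gather \<kappa> y" for x y
    by (rule ell1_eqI) (simp add: gather_nth[OF assms] plus_ell1.rep_eq)
  show "gather \<kappa> (r *\<^sub>R x) = r *\<^sub>R gather \<kappa> x" for r x
    by (rule ell1_eqI) (simp add: gather_nth[OF assms] scaleR_ell1.rep_eq)
  show "norm (gather \<kappa> x) \<le> norm x * 1" for x
    using suminf_reindex_mono[OF summable_ell1_nth assms, of x]
    by (simp add: norm_ell1.rep_eq gather_nth[OF assms] o_def)
qed

lemma spread_gather:
  assumes "inj \<kappa>" "x \<in> supported_on (range \<kappa>)"
  shows "spread \<kappa> (gather \<kappa> x) = x"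
proof (rule ell1_eqI)
  show "ell1_nth (spread \<kappa> (gather \<kappa> x)) k = ell1_nth x k" for k
  proof (cases "k \<in> range \<kappa>")
    case True
    then show ?thesis using assms(1) by (auto simp: spread_nth gather_nth)
  next
    case False
    then show ?thesis
      using assms(2) spread_supported_on[of \<kappa> "gather \<kappa> x"] by (simp add: supported_on_def)
  qed
qed

lemma homeomorphism_spread:
  assumes "inj \<kappa>"
  shows "homeomorphism UNIV (supported_on (range \<kappa>)) (spread \<kappa>) (gather \<kappa>)"
proof (rule homeomorphismI)
  show "gather \<kappa> (spread \<kappa> t) = t" for t
    by (rule ell1_eqI) (simp add: assms gather_nth spread_nth)
  show "continuous_on UNIV (spread \<kappa>)"
    by (rule linear_continuous_on[OF bounded_linear_spread])
  show "continuous_on (supported_on (range \<kappa>)) (gather \<kappa>)"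
    by (rule linear_continuous_on[OF bounded_linear_gather[OF assms]])
  show "spread \<kappa> ` UNIV \<subseteq> supported_on (range \<kappa>)"
    using spread_supported_on by blast
qed (simp_all add: spread_gather[OF assms])

section \<open>Weak* continuity on sequences with restricted support\<close>

lemma topspace_initial_topology:
  assumes "F \<noteq> {}"
  shows "topspace (initial_topology F) = UNIV"
proof -
  obtain f where "f \<in> F" using assms by blast
  then have "f -` UNIV \<in> {f -` V |f V. f \<in> F \<and> open V}" using open_UNIV by blast
  then show ?thesis unfolding initial_topology_def topology_generated_by_topspace by auto
qed

text \<open>
  A bounded functional pulled back along \<open>B\<close> is given by a bounded sequence, which need not be a
  null sequence. On sequences supported on \<open>range \<kappa>\<close> the entries off that range may be replaced
  by zero, so that weak convergence of \<open>\<zeta> (\<kappa> n)\<close> to zero suffices to represent it by an element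
  of \<^const>\<open>c0\<close>.
\<close>

lemma weak_star_weak_continuous_synthesis:
  fixes \<zeta> :: "nat \<Rightarrow> ell2"
  assumes unit: "\<And>k. \<zeta> k \<in> sphere 0 1"
    and null: "\<And>f :: ell2 \<Rightarrow> real. bounded_linear f \<Longrightarrow> (\<lambda>n. f (\<zeta> (\<kappa> n))) \<longlonglongrightarrow> 0"
  shows "continuous_map (subtopology weak_star_topology (supported_on (range \<kappa>))) weak_topology
    (\<lambda>x. \<Sum>k. ell1_nth x k *\<^sub>R \<zeta> k)" (is "continuous_map (subtopology _ ?U) _ ?B")
proof -
  have ts: "topspace (subtopology weak_star_topology ?U) = ?U"
  proof -
    have "{\<lambda>x. ell1_c0_pairing x c |c. c \<in> c0} \<noteq> {}"
      using tendsto_const[of "0 :: real" sequentially] by (auto simp: c0_def)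
    then show ?thesis
      unfolding weak_star_topology_def by (simp add: topspace_initial_topology)
  qed
  have rep: "\<exists>c\<in>c0. \<forall>x\<in>?U. f (?B x) = ell1_c0_pairing x c"
    if f: "bounded_linear f" for f :: "ell2 \<Rightarrow> real"
  proof (intro bexI ballI)
    define c where "c k = (if k \<in> range \<kappa> then f (\<zeta> k) else 0)" for k
    show "c \<in> c0"
      unfolding c0_def mem_Collect_eq
    proof (rule LIMSEQ_I)
      fix r :: real assume "r > 0"
      then obtain N where N: "\<And>n. n \<ge> N \<Longrightarrow> \<bar>f (\<zeta> (\<kappa> n))\<bar> < r"
        using LIMSEQ_D[OF null[OF f], of r] by auto
      \<comment> \<open>Only the positions \<open>\<kappa> n\<close> with \<open>n < N\<close> can carry an entry of size at least \<open>r\<close>.\<close>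
      have "norm (c k - 0) < r" if k: "k \<ge> Suc (Max (insert 0 (\<kappa> ` {..<N})))" for k
      proof (cases "k \<in> range \<kappa>")
        case True
        then obtain n where n: "k = \<kappa> n" by auto
        have "n \<ge> N"
        proof (rule ccontr)
          assume "\<not> n \<ge> N"
          then have "k \<le> Max (insert 0 (\<kappa> ` {..<N}))" unfolding n by (intro Max_ge) auto
          with k show False by simp
        qed
        then show ?thesis using N n by (simp add: c_def)
      qed (use \<open>r > 0\<close> in \<open>simp add: c_def\<close>)
      then show "\<exists>no. \<forall>k\<ge>no. norm (c k - 0) < r" by blast
    qed
    fix x assume x: "x \<in> ?U"
    have "f (?B x) = (\<Sum>k. f (ell1_nth x k *\<^sub>R \<zeta> k))"
      by (rule bounded_linear.suminf[OF f summable_synthesis[OF unit]])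
    also have "\<dots> = (\<Sum>k. ell1_nth x k * c k)"
      using x by (intro suminf_cong)
        (auto simp: c_def supported_on_def linear_cmul[OF bounded_linear.linear[OF f]])
    finally show "f (?B x) = ell1_c0_pairing x c" by (simp add: ell1_c0_pairing_def)
  qed
  show ?thesis
    unfolding weak_topology_def initial_topology_def
  proof (rule continuous_on_generated_topo)
    fix W assume "W \<in> {f -` V |f V. f \<in> {f :: ell2 \<Rightarrow> real. bounded_linear f} \<and> open V}"
    then obtain f :: "ell2 \<Rightarrow> real" and V where W: "W = f -` V" "bounded_linear f" "open V" by blast
    obtain c where c: "c \<in> c0" "\<And>x. x \<in> ?U \<Longrightarrow> f (?B x) = ell1_c0_pairing x c"
      using rep[OF W(2)] by blast
    have "openin weak_star_topology ((\<lambda>x. ell1_c0_pairing x c) -` V)"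
      unfolding weak_star_topology_def initial_topology_def
      using c(1) W(3) by (intro topology_generated_by_Basis) blast
    moreover have "?B -` W \<inter> ?U = (\<lambda>x. ell1_c0_pairing x c) -` V \<inter> ?U"
      using c(2) W(1) by auto
    ultimately show "openin (subtopology weak_star_topology ?U)
        (?B -` W \<inter> topspace (subtopology weak_star_topology ?U))"
      unfolding ts by (auto simp: openin_subtopology)
  next
    have "{f :: ell2 \<Rightarrow> real. bounded_linear f} \<noteq> {}"
      using bounded_linear_zero by blast
    from topspace_initial_topology[OF this]
    show "?B ` topspace (subtopology weak_star_topology ?U)
        \<subseteq> \<Union> {f -` V |f V. f \<in> {f :: ell2 \<Rightarrow> real. bounded_linear f} \<and> open V}"
      unfolding initial_topology_def topology_generated_by_topspace by (simp only: subset_UNIV)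
  qed
qed

section \<open>The subspace\<close>

lemma summable_ell1_nth_sq: "summable (\<lambda>n. (ell1_nth x n)\<^sup>2)"
proof (rule summable_comparison_test'[where N = 0])
  show "summable (\<lambda>n. norm x * \<bar>ell1_nth x n\<bar>)" by (intro summable_mult summable_ell1_nth)
  show "norm ((ell1_nth x n)\<^sup>2) \<le> norm x * \<bar>ell1_nth x n\<bar>" for n
    using mult_right_mono[OF abs_ell1_nth_le[of x n], of "\<bar>ell1_nth x n\<bar>"]
    by (simp add: power2_eq_square)
qed

theorem proposition4p3:
  fixes \<zeta> :: "nat \<Rightarrow> ell2" and B :: "ell1 \<Rightarrow> ell2"
  assumes "inj \<zeta>"
    and "range \<zeta> \<subseteq> sphere 0 1"
    and "sphere 0 1 \<subseteq> closure (range \<zeta>)"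
    and "B = (\<lambda>x. \<Sum>k. ell1_nth x k *\<^sub>R \<zeta> k)"
  shows "\<exists>U :: ell1 set. subspace U \<and> closed U \<and> \<not> finite_dimensional U
    \<and> (\<exists>T S. linear (T :: ell1 \<Rightarrow> ell1) \<and> homeomorphism UNIV U T S)
    \<and> inj_on B U
    \<and> continuous_map (subtopology weak_star_topology U) weak_topology B
    \<and> closure (B ` U) = UNIV"
proof -
  have unit: "\<zeta> k \<in> sphere 0 1" for k using assms(2) by blast
  \<comment> \<open>The factor \<open>1/4\<close> makes the sum less than \<open>1\<close>, as the expansion lemma requires, and each term
    small enough to force the chosen indices apart.\<close>
  define \<delta> :: "nat \<Rightarrow> real" where "\<delta> n = (1/4) * (1/2) ^ n" for n
  have \<delta>_sums: "\<delta> sums (1/2)"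
    using sums_mult[OF geometric_sums[of "1/2 :: real"], of "1/4"] by (simp add: \<delta>_def[abs_def])
  have "\<exists>k. norm (ell2_unit n - \<zeta> k) \<le> \<delta> n" for n
  proof -
    have "ell2_unit n \<in> closure (range \<zeta>)" using assms(3) norm_ell2_unit by auto
    moreover have "\<delta> n > 0" by (simp add: \<delta>_def)
    ultimately obtain k where "dist (\<zeta> k) (ell2_unit n) < \<delta> n"
      unfolding closure_approachable by blast
    then show ?thesis by (metis dist_commute dist_norm less_imp_le)
  qed
  then obtain \<kappa> where \<kappa>: "\<And>n. norm (ell2_unit n - \<zeta> (\<kappa> n)) \<le> \<delta> n" by metis
  have \<delta>_le: "\<delta> n \<le> 1/4" for n by (simp add: \<delta>_def power_le_one)
  \<comment> \<open>A common \<open>\<zeta> (\<kappa> m)\<close> within \<open>1/4\<close> of both would put distinct unit vectors, which differ by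
    \<open>1\<close> in a coordinate, within \<open>1/2\<close> of each other.\<close>
  have inj: "inj \<kappa>"
  proof (rule injI, rule ccontr)
    fix m n assume eq: "\<kappa> m = \<kappa> n" and "m \<noteq> n"
    then have "1 \<le> norm (ell2_unit m - ell2_unit n)"
      using abs_ell2_nth_le[of "ell2_unit m - ell2_unit n" m]
      by (simp add: ell2_nth_minus ell2_unit.rep_eq)
    also have "\<dots> \<le> norm (ell2_unit m - \<zeta> (\<kappa> m)) + norm (ell2_unit n - \<zeta> (\<kappa> n))"
      using norm_triangle_ineq4[of "ell2_unit m - \<zeta> (\<kappa> m)" "ell2_unit n - \<zeta> (\<kappa> n)"]
      by (simp add: eq)
    also have "\<dots> \<le> 1/4 + 1/4" using \<kappa> \<delta>_le by (intro add_mono) (meson order_trans)+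
    finally show False by simp
  qed
  let ?U = "supported_on (range \<kappa>)"
  have blB: "bounded_linear B" unfolding assms(4) by (rule bounded_linear_synthesis[OF unit])
  have B_unit: "B (ell1_unit k) = \<zeta> k" for k
  proof -
    have "(\<Sum>j. ell1_nth (ell1_unit k) j *\<^sub>R \<zeta> j) = (\<Sum>j\<in>{k}. ell1_nth (ell1_unit k) j *\<^sub>R \<zeta> j)"
      by (rule suminf_finite) (auto simp: ell1_unit.rep_eq)
    then show ?thesis by (simp add: assms(4) ell1_unit.rep_eq)
  qed
  have expansion: "\<exists>!a. (\<lambda>n. ell2_nth a n *\<^sub>R \<zeta> (\<kappa> n)) sums w" for w
    using \<delta>_sums by (intro perturbed_unit_vectors_expansion[OF \<kappa>]) (auto simp: sums_iff)
  have injB: "inj_on B ?U"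
  proof (rule inj_onI)
    fix x y assume xy: "x \<in> ?U" "y \<in> ?U" "B x = B y"
    define a where "a z = Abs_ell2 (ell1_nth (gather \<kappa> z))" for z
    have a: "ell2_nth (a z) = ell1_nth (gather \<kappa> z)" for z
      unfolding a_def by (simp add: Abs_ell2_inverse summable_ell1_nth_sq)
    have "(\<lambda>n. ell2_nth (a z) n *\<^sub>R \<zeta> (\<kappa> n)) sums B z" if "z \<in> ?U" for z
      using bounded_linear.sums[OF blB spread_sums, of "gather \<kappa> z" \<kappa>] inj that
      by (simp add: a spread_gather linear_cmul[OF bounded_linear.linear[OF blB]] B_unit)
    then have "a x = a y" using xy expansion by metis
    then have "gather \<kappa> x = gather \<kappa> y" by (metis a ell1_eqI)
    then show "x = y" using xy inj by (metis spread_gather)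
  qed
  have dense: "closure (B ` ?U) = UNIV"
  proof -
    have "w \<in> closure (B ` ?U)" for w
    proof -
      obtain a where a: "(\<lambda>n. ell2_nth a n *\<^sub>R \<zeta> (\<kappa> n)) sums w" using expansion by blast
      define y where "y N = (\<Sum>n<N. ell2_nth a n *\<^sub>R ell1_unit (\<kappa> n))" for N
      have "y N \<in> ?U" for N
        unfolding y_def
        by (intro subspace_sum subspace_scale subspace_supported_on ell1_unit_supported_on) auto
      moreover have "B (y N) = (\<Sum>n<N. ell2_nth a n *\<^sub>R \<zeta> (\<kappa> n))" for N
        using bounded_linear.linear[OF blB]
        by (simp add: y_def linear_sum linear_cmul B_unit)
      then have "(\<lambda>N. B (y N)) \<longlonglongrightarrow> w" using a by (simp add: sums_def)
      ultimately show ?thesis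
        unfolding closure_sequential by (intro exI[of _ "\<lambda>N. B (y N)"]) simp
    qed
    then show ?thesis by blast
  qed
  have "(\<lambda>n. f (\<zeta> (\<kappa> n))) \<longlonglongrightarrow> 0" if f: "bounded_linear f" for f :: "ell2 \<Rightarrow> real"
  proof -
    have "(\<lambda>n. ell2_unit n - \<zeta> (\<kappa> n)) \<longlonglongrightarrow> 0"
      using \<delta>_sums by (intro Lim_null_comparison[OF _ summable_LIMSEQ_zero[of \<delta>]])
        (auto simp: \<kappa> sums_iff)
    from bounded_linear.tendsto_zero[OF f this]
    have "(\<lambda>n. f (ell2_unit n) - f (ell2_unit n - \<zeta> (\<kappa> n))) \<longlonglongrightarrow> 0"
      using tendsto_diff[OF ell2_unit_weakly_null[OF f]] by fastforce
    then show ?thesis by (simp add: linear_diff[OF bounded_linear.linear[OF f]])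
  qed
  then have "continuous_map (subtopology weak_star_topology ?U) weak_topology B"
    unfolding assms(4) using unit by (intro weak_star_weak_continuous_synthesis)
  moreover have "infinite (range \<kappa>)" using inj by (simp add: finite_image_iff)
  ultimately show ?thesis
    using subspace_supported_on closed_supported_on infinite_dimensional_supported_on
      bounded_linear.linear[OF bounded_linear_spread] homeomorphism_spread[OF inj] injB dense
    by blast
qed

end
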